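(* Fix integers $t>r\ge 3$. Then $m_k(K_t^r)=k^{r+o(1)}$, where $o(1)\to 0$ as $k\to\infty$. On the other hand, for each integer $s\ge 3$ there exists $\varepsilon=\varepsilon_s>0$ such that $m_k(K_s)>k^{2+\varepsilon}$ for all sufficiently large $k$.
   Context: An $r$-graph is a hypergraph all of whose edges have exactly $r$ vertices. $K_t^r$ is the complete $r$-graph on $t$ vertices, and $K_s$ is the complete graph on $s$ vertices. The chromatic number is the minimum number of colors in a vertex coloring with no monochromatic edge. For an $r$-graph $H$, $m_k(H)$ is the minimum number of edges in an $r$-graph that contains no copy of $H$ (as a not necessarily induced subhypergraph) and has chromatic number greater than $k$. *)

theory Defs
  imports Complex_Main
begin

type_synonym 'a hypergraph = "'a set \<times> 'a set set"

abbreviation hverts :: "'a hypergraph \<Rightarrow> 'a set" where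
  "hverts G \<equiv> fst G"

abbreviation hedges :: "'a hypergraph \<Rightarrow> 'a set set" where
  "hedges G \<equiv> snd G"

definition r_graph :: "nat \<Rightarrow> 'a hypergraph \<Rightarrow> bool" where
  "r_graph r G \<longleftrightarrow> finite (hverts G) \<and> (\<forall>e\<in>hedges G. e \<subseteq> hverts G \<and> card e = r)"

definition complete_r_graph :: "nat \<Rightarrow> nat \<Rightarrow> nat hypergraph" where
  "complete_r_graph r t = ({..<t}, {e. e \<subseteq> {..<t} \<and> card e = r})"

definition contains_copy :: "'a hypergraph \<Rightarrow> 'b hypergraph \<Rightarrow> bool" where
  "contains_copy G H \<longleftrightarrow>
     (\<exists>f. inj_on f (hverts H) \<and> f ` hverts H \<subseteq> hverts G \<and> (\<forall>e\<in>hedges H. f ` e \<in> hedges G))"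

definition monochromatic :: "('a \<Rightarrow> nat) \<Rightarrow> 'a set \<Rightarrow> bool" where
  "monochromatic c e \<longleftrightarrow> (\<exists>a. \<forall>v\<in>e. c v = a)"

definition proper_coloring :: "'a hypergraph \<Rightarrow> nat \<Rightarrow> ('a \<Rightarrow> nat) \<Rightarrow> bool" where
  "proper_coloring G k c \<longleftrightarrow> c ` hverts G \<subseteq> {..<k} \<and> (\<forall>e\<in>hedges G. \<not> monochromatic c e)"

text \<open>For \<open>r \<ge> 2\<close>, every \<open>r\<close>-graph has a proper coloring (give the finitely many vertices
  distinct colors), so the minimum is attained.\<close>

definition chromatic_number :: "'a hypergraph \<Rightarrow> nat" where
  "chromatic_number G = (LEAST k. \<exists>c. proper_coloring G k c)"

text \<open>The uniformity \<open>r\<close> is an explicit argument, since an edgeless \<open>H\<close> does not determine it.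
  Every finite hypergraph is isomorphic to one with vertices in \<open>nat\<close>, so taking the minimum over
  vertex sets in \<open>nat\<close> is no restriction. The \<open>LEAST\<close> carries no information if there is no
  \<open>H\<close>-free \<open>r\<close>-graph of chromatic number greater than \<open>k\<close>; for complete \<open>H\<close> on more than
  \<open>r \<ge> 2\<close> vertices such \<open>r\<close>-graphs always exist.\<close>

definition min_edges :: "nat \<Rightarrow> 'b hypergraph \<Rightarrow> nat \<Rightarrow> nat" where
  "min_edges r H k =
     (LEAST m. \<exists>G :: nat hypergraph.
        r_graph r G \<and> \<not> contains_copy G H \<and> chromatic_number G > k \<and> card (hedges G) = m)"

end

theory Submission
  imports Defs "HOL-Library.FuncSet" "HOL-Library.Nat_Bijection" "HOL-Real_Asymp.Real_Asymp"
begin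

text \<open>Lower bound for \<open>r \<ge> 3\<close>: with at most \<open>q ^ r\<close> edges, some \<open>q\<close>-coloring leaves at most \<open>q\<close>
  monochromatic edges, and recoloring one vertex of each with \<open>q\<close> further colors makes the coloring
  proper. Upper bound: choose random rows \<open>h v \<subseteq> {..<n}\<close> and let an \<open>r\<close>-set with lowest vertices
  \<open>a < b < c\<close> be an edge iff \<open>b \<in> h a\<close> and \<open>c \<notin> h a\<close>. No \<open>r + 1\<close> vertices span all possible
  edges, and independent sets have size \<open>O(log n)\<close>, so \<open>n = O(k log k)\<close> vertices force more than
  \<open>k\<close> colors.

  For \<open>K_s\<close>-free graphs with \<open>m\<close> edges that are not \<open>k\<close>-colorable, a minimal non-\<open>k\<close>-colorable
  induced subgraph has minimum degree at least \<open>k\<close>, hence at most \<open>2m / k\<close> vertices. If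
  \<open>m \<le> k powr (2 + \<epsilon>)\<close>, Ramsey's bound, applied repeatedly to split off independent sets,
  colors it with \<open>k\<close> colors.\<close>

section \<open>Chromatic number and \<open>min_edges\<close>: basic facts\<close>

lemma chromatic_number_gtD:
  assumes "chromatic_number G > k"
  shows "\<not> proper_coloring G k c"
  using assms not_less_Least unfolding chromatic_number_def by blast

lemma proper_coloring_mono:
  "proper_coloring G j c \<Longrightarrow> j \<le> k \<Longrightarrow> proper_coloring G k c"
  unfolding proper_coloring_def by fastforce

lemma ex_proper_coloring:
  assumes "r_graph r G" "2 \<le> r"
  shows "\<exists>k c. proper_coloring G k c"
proof -
  obtain c where c: "inj_on c (hverts G)" "c ` hverts G = {..<card (hverts G)}"
    using assms ex_bij_betw_finite_nat[of "hverts G"]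
    unfolding r_graph_def bij_betw_def by (metis atLeast0LessThan)
  have "\<not> monochromatic c e" if "e \<in> hedges G" for e
  proof
    assume "monochromatic c e"
    then obtain a where a: "\<forall>v\<in>e. c v = a" unfolding monochromatic_def by blast
    have e: "e \<subseteq> hverts G" "card e = r" using assms that unfolding r_graph_def by auto
    then have "inj_on c e" using c inj_on_subset by blast
    then have "card e = card (c ` e)" by (simp add: card_image)
    also have "\<dots> \<le> card {a}" using a by (intro card_mono) auto
    finally show False using e assms by simp
  qed
  then show ?thesis using c unfolding proper_coloring_def by blast
qed

lemma chromatic_number_gtI:
  assumes "r_graph r G" "2 \<le> r" "\<And>c. \<not> proper_coloring G k c"
  shows "chromatic_number G > k"
proof -
  obtain c where "proper_coloring G (chromatic_number G) c"
    using LeastI_ex[OF ex_proper_coloring[OF assms(1,2)]] unfolding chromatic_number_def by blast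
  then show ?thesis using proper_coloring_mono assms(3) not_less by blast
qed

lemma min_edges_le:
  fixes G :: "nat hypergraph"
  assumes "r_graph r G" "\<not> contains_copy G H" "chromatic_number G > k"
  shows "min_edges r H k \<le> card (hedges G)"
  unfolding min_edges_def using assms by (intro Least_le) blast

text \<open>\<open>LEAST\<close> yields an extremal hypergraph only once some witness is known. The
  lower bounds on \<open>min_edges\<close> therefore start from a construction: a row graph or a
  shift graph.\<close>

lemma min_edges_attained:
  fixes G :: "nat hypergraph"
  assumes "r_graph r G" "\<not> contains_copy G H" "chromatic_number G > k"
  obtains G' :: "nat hypergraph" where "r_graph r G'" "\<not> contains_copy G' H"
    "chromatic_number G' > k" "card (hedges G') = min_edges r H k"
proof -
  have "\<exists>G' :: nat hypergraph. r_graph r G' \<and> \<not> contains_copy G' H \<and>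
    chromatic_number G' > k \<and> card (hedges G') = min_edges r H k"
    unfolding min_edges_def by (rule LeastI_ex) (use assms in blast)
  then show thesis using that by blast
qed

lemma finite_hedges: "r_graph r G \<Longrightarrow> finite (hedges G)"
  unfolding r_graph_def by (rule finite_subset[of _ "Pow (hverts G)"]) auto

subsection \<open>Few edges imply a small chromatic number\<close>

lemma card_monochromatic_colorings:
  assumes "finite V" "e \<subseteq> V" "a < q"
  shows "card {c \<in> V \<rightarrow>\<^sub>E {..<q}. \<forall>v\<in>e. c v = a} = q ^ (card V - card e)"
proof -
  have "{c \<in> V \<rightarrow>\<^sub>E {..<q}. \<forall>v\<in>e. c v = a} = PiE V (\<lambda>v. if v \<in> e then {a} else {..<q})"
    using assms by (auto simp: PiE_iff subset_iff extensional_def split: if_splits)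
  also have "card \<dots> = (\<Prod>v\<in>V. if v \<in> e then 1 else q)"
    using assms by (subst card_PiE) (auto intro!: prod.cong)
  also have "\<dots> = (\<Prod>v\<in>V - e. q)"
    using assms by (intro prod.mono_neutral_cong_right) auto
  finally show ?thesis using assms by (simp add: card_Diff_subset finite_subset)
qed

text \<open>Averaging over all \<open>q\<close>-colorings: each edge is monochromatic in at most a
  fraction 1/q^(r-1) of them, so some coloring does no worse than this average. The multiplied form
  avoids division.\<close>

lemma ex_coloring_few_monochromatic:
  assumes G: "r_graph r G" and "1 \<le> r" "1 \<le> q"
  shows "\<exists>c. c ` hverts G \<subseteq> {..<q} \<and>
    card {e \<in> hedges G. monochromatic c e} * q ^ (r - 1) \<le> card (hedges G)"
proof (cases "hedges G = {}")
  case True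
  then show ?thesis using assms by (intro exI[of _ "\<lambda>_. 0"]) auto
next
  case False
  define V where "V = hverts G"
  define E where "E = hedges G"
  have fin: "finite V" "finite E" and sub: "\<And>e. e \<in> E \<Longrightarrow> e \<subseteq> V" "\<And>e. e \<in> E \<Longrightarrow> card e = r"
    using G finite_hedges[OF G] unfolding r_graph_def V_def E_def by auto
  define F where "F = V \<rightarrow>\<^sub>E {..<q}"
  have finF: "finite F" unfolding F_def using fin by (intro finite_PiE) auto
  have cF: "card F = q ^ card V" unfolding F_def using fin by (simp add: card_PiE)
  obtain e0 where "e0 \<in> E" using False E_def by blast
  \<comment> \<open>Makes the truncated \<open>card V - r\<close> exact, so that the exponents at
    the end add up to \<open>card V\<close>.\<close>
  then have rV: "r \<le> card V" using sub card_mono[OF fin(1)] by metis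
  have mono: "card {c \<in> F. monochromatic c e} \<le> q * q ^ (card V - r)" if "e \<in> E" for e
  proof -
    have e: "e \<subseteq> V" "e \<noteq> {}" using sub(1)[OF that] sub(2)[OF that] assms(2) by auto
    have "{c \<in> F. monochromatic c e} \<subseteq> (\<Union>a<q. {c \<in> F. \<forall>v\<in>e. c v = a})"
    proof
      fix c assume "c \<in> {c \<in> F. monochromatic c e}"
      then obtain a where a: "c \<in> F" "\<forall>v\<in>e. c v = a" unfolding monochromatic_def by blast
      obtain v where "v \<in> e" using e by blast
      then have "c v \<in> {..<q}" using a e unfolding F_def by (blast dest: PiE_mem)
      then show "c \<in> (\<Union>a<q. {c \<in> F. \<forall>v\<in>e. c v = a})" using a \<open>v \<in> e\<close> by auto
    qed
    then have "card {c \<in> F. monochromatic c e} \<le> card (\<Union>a<q. {c \<in> F. \<forall>v\<in>e. c v = a})"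
      using finF by (intro card_mono) auto
    also have "\<dots> \<le> (\<Sum>a<q. card {c \<in> F. \<forall>v\<in>e. c v = a})" by (rule card_UN_le) simp
    also have "\<dots> = q * q ^ (card V - r)"
      using card_monochromatic_colorings[OF fin(1) e(1)] sub(2)[OF that] unfolding F_def by simp
    finally show ?thesis .
  qed
  show ?thesis
  proof (rule ccontr)
    assume neg: "\<not> ?thesis"
    have big: "card E < card {e \<in> E. monochromatic c e} * q ^ (r - 1)" if "c \<in> F" for c
    proof -
      have "c ` hverts G \<subseteq> {..<q}" using that unfolding F_def V_def by auto
      then show ?thesis using neg unfolding E_def by (meson not_le)
    qed
    have "card F > 0" using cF assms by simp
    then have "F \<noteq> {}" by auto
    \<comment> \<open>Double counting of pairs of a coloring and an edge monochromatic under
      it.\<close>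
    have "(\<Sum>c\<in>F. card E) < (\<Sum>c\<in>F. card {e \<in> E. monochromatic c e} * q ^ (r - 1))"
      using finF \<open>F \<noteq> {}\<close> big by (intro sum_strict_mono) auto
    also have "\<dots> = (\<Sum>c\<in>F. \<Sum>e\<in>E. of_bool (monochromatic c e)) * q ^ (r - 1)"
      using fin by (simp add: sum_distrib_right Collect_conj_eq)
    also have "\<dots> = (\<Sum>e\<in>E. \<Sum>c\<in>F. of_bool (monochromatic c e)) * q ^ (r - 1)"
      by (subst sum.swap) simp
    also have "\<dots> = (\<Sum>e\<in>E. card {c \<in> F. monochromatic c e}) * q ^ (r - 1)"
      using finF by (simp add: Collect_conj_eq)
    also have "\<dots> \<le> (\<Sum>e\<in>E. q * q ^ (card V - r)) * q ^ (r - 1)"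
      using mono by (intro mult_right_mono sum_mono) auto
    also have "\<dots> = card E * q ^ (1 + (card V - r) + (r - 1))" by (simp add: power_add)
    also have "1 + (card V - r) + (r - 1) = card V" using rV assms by simp
    finally show False using cF by (simp add: mult.commute)
  qed
qed

lemma proper_coloring_of_few_edges:
  assumes G: "r_graph r G" and r: "2 \<le> r" and q: "1 \<le> q" and le: "card (hedges G) \<le> q ^ r"
  shows "\<exists>c. proper_coloring G (2 * q) c"
proof -
  obtain c where c: "c ` hverts G \<subseteq> {..<q}"
    and few: "card {e \<in> hedges G. monochromatic c e} * q ^ (r - 1) \<le> card (hedges G)"
    using ex_coloring_few_monochromatic[OF G, of q] r q by auto
  define M where "M = {e \<in> hedges G. monochromatic c e}"
  have finM: "finite M" using finite_hedges[OF G] M_def by simp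
  have ecard: "e \<subseteq> hverts G" "card e = r" if "e \<in> hedges G" for e
    using G that unfolding r_graph_def by auto
  have "card M * q ^ (r - 1) \<le> q * q ^ (r - 1)"
    using few le r unfolding M_def by (metis (no_types, lifting) One_nat_def Suc_le_eq le_trans
        less_le_trans pos2 power_eq_if not_gr_zero)
  then have Mq: "card M \<le> q" using q by simp
  define pick where "pick e = (SOME v. v \<in> e)" for e :: "'a set"
  have pick: "pick e \<in> e" if "e \<in> hedges G" for e
  proof -
    have "e \<noteq> {}" using ecard[OF that] r by auto
    then show ?thesis unfolding pick_def by (simp add: some_in_eq)
  qed
  define U where "U = pick ` M"
  have finU: "finite U" and cardU: "card U \<le> q"
    using finM Mq card_image_le[OF finM, of pick] unfolding U_def by auto
  obtain d where d: "inj_on d U" "d ` U = {..<card U}"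
    using ex_bij_betw_finite_nat[OF finU] unfolding bij_betw_def by (metis atLeast0LessThan)
  \<comment> \<open>\<open>U\<close> contains a vertex of each monochromatic edge. Its members get
    distinct colors from \<open>q\<close> on, and \<open>card U \<le> q\<close> keeps these below
    \<open>2 * q\<close>.\<close>
  define c' where "c' v = (if v \<in> U then q + d v else c v)" for v
  have "c' ` hverts G \<subseteq> {..<2 * q}"
  proof
    fix y assume "y \<in> c' ` hverts G"
    then obtain v where v: "v \<in> hverts G" "y = c' v" by blast
    show "y \<in> {..<2 * q}"
    proof (cases "v \<in> U")
      case True
      then have "d v < card U" using d by blast
      then show ?thesis using v True cardU c'_def by simp
    next
      case False
      then have "c v < q" using v c by blast
      then show ?thesis using v False c'_def by simp
    qed
  qed
  moreover have "\<not> monochromatic c' e" if e: "e \<in> hedges G" for e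
  proof
    assume "monochromatic c' e"
    then obtain a where a: "\<And>v. v \<in> e \<Longrightarrow> c' v = a" unfolding monochromatic_def by blast
    show False
    proof (cases "e \<inter> U = {}")
      case True
      then have "c v = a" if "v \<in> e" for v using a[OF that] that c'_def by auto
      then have "e \<in> M" using e unfolding M_def monochromatic_def by blast
      then show False using True pick[OF e] U_def by blast
    next
      case False
      then obtain u where u: "u \<in> e" "u \<in> U" by blast
      \<comment> \<open>As \<open>r \<ge> 2\<close>, there is a second vertex \<open>w\<close>; its
        color is either an old one, below \<open>q\<close>, or a new one different from that of
        \<open>u\<close>.\<close>
      have "\<not> e \<subseteq> {u}"
        using ecard(2)[OF e] r card_mono[of "{u}" e] by auto
      then obtain w where w: "w \<in> e" "w \<noteq> u" by blast
      have eq: "c' w = c' u" using a u w by simp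
      have "c w < q" using w ecard(1)[OF e] c by blast
      then show False using eq u w d(1) unfolding c'_def by (auto split: if_splits dest: inj_onD)
    qed
  qed
  ultimately show ?thesis unfolding proper_coloring_def by blast
qed

subsection \<open>Hypergraphs built from a family of rows\<close>

text \<open>Edges of the hypergraphs below are decided by their three lowest vertices. The other
  \<open>r - 3\<close> vertices are filler, so every \<open>r \<ge> 3\<close> is treated like
  3.\<close>

definition lowest3 :: "nat set \<Rightarrow> nat \<Rightarrow> nat \<Rightarrow> nat \<Rightarrow> bool" where
  "lowest3 e a b c \<longleftrightarrow> a < b \<and> b < c \<and> {a, b, c} \<subseteq> e \<and> (\<forall>x \<in> e - {a, b, c}. c < x)"

text \<open>Here \<open>h a\<close> acts as row \<open>a\<close> of a 0/1 matrix. Complete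
  subhypergraphs on more than \<open>r\<close> vertices are excluded for every \<open>h\<close>; the
  choice of \<open>h\<close> matters only for independent sets.\<close>

definition row_graph :: "nat \<Rightarrow> nat \<Rightarrow> (nat \<Rightarrow> nat set) \<Rightarrow> nat hypergraph" where
  "row_graph r n h = ({..<n}, {e. e \<subseteq> {..<n} \<and> card e = r \<and>
     (\<exists>a b c. lowest3 e a b c \<and> b \<in> h a \<and> c \<notin> h a)})"

lemma r_graph_row_graph: "r_graph r (row_graph r n h)"
  unfolding r_graph_def row_graph_def by auto

text \<open>Identifies the existential triple in \<open>row_graph\<close> with a triple already at
  hand.\<close>

lemma lowest3_unique:
  assumes "lowest3 e a b c" "lowest3 e a' b' c'"
  shows "a = a'" "b = b'" "c = c'"
proof -
  have ord: "a < b" "b < c" "a' < b'" "b' < c'" using assms unfolding lowest3_def by auto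
  have lo: "x = a \<or> x = b \<or> x = c \<or> c < x" if "x \<in> e" for x
    using assms(1) that unfolding lowest3_def by blast
  have lo': "x = a' \<or> x = b' \<or> x = c' \<or> c' < x" if "x \<in> e" for x
    using assms(2) that unfolding lowest3_def by blast
  have mem: "a \<in> e" "b \<in> e" "c \<in> e" "a' \<in> e" "b' \<in> e" "c' \<in> e"
    using assms unfolding lowest3_def by auto
  show a: "a = a'" using ord lo[OF mem(4)] lo'[OF mem(1)] by linarith
  show b: "b = b'" using ord a lo[OF mem(5)] lo'[OF mem(2)] by linarith
  show "c = c'" using ord a b lo[OF mem(6)] lo'[OF mem(3)] by linarith
qed

lemma Min_split:
  fixes T :: "nat set"
  assumes "finite T" "card T = Suc m"
  shows "\<exists>v T'. T = insert v T' \<and> v \<notin> T' \<and> finite T' \<and> card T' = m \<and> (\<forall>x\<in>T'. v < x)"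
proof -
  have "T \<noteq> {}" using assms by auto
  then have v: "Min T \<in> T" using assms by simp
  have "Min T < x" if "x \<in> T - {Min T}" for x
    using that assms Min_le[of T x] by (simp add: order_less_le)
  then show ?thesis using v assms by (intro exI[of _ "Min T"] exI[of _ "T - {Min T}"]) auto
qed

text \<open>Let \<open>v1 < v2 < v3 < v4\<close> be the first vertices of a copy. An edge starting with
  \<open>v1, v2, v3\<close> forces \<open>v3\<close> out of the row of \<open>v1\<close>, while an edge starting with
  \<open>v1, v3, v4\<close> forces it in.\<close>

lemma row_graph_free:
  assumes "3 \<le> r" "r < t"
  shows "\<not> contains_copy (row_graph r n h) (complete_r_graph r t)"
proof
  assume "contains_copy (row_graph r n h) (complete_r_graph r t)"
  then obtain f where f: "inj_on f {..<t}"
    and fe: "\<And>e. e \<subseteq> {..<t} \<Longrightarrow> card e = r \<Longrightarrow> f ` e \<in> hedges (row_graph r n h)"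
    unfolding contains_copy_def complete_r_graph_def by auto
  define T where "T = f ` {..<t}"
  have E: "\<exists>a b c. lowest3 e a b c \<and> b \<in> h a \<and> c \<notin> h a" if e: "e \<subseteq> T" "card e = r" for e
  proof -
    obtain d where d: "d \<subseteq> {..<t}" "e = f ` d" using e(1) unfolding T_def by (meson subset_imageE)
    then have "card d = r" using e(2) f card_image inj_on_subset by metis
    then show ?thesis using fe[OF d(1)] d(2) unfolding row_graph_def by auto
  qed
  have T: "finite T" "card T = t" using f unfolding T_def by (auto simp: card_image)
  obtain u where u: "t = Suc (Suc (Suc (Suc u)))" "r - 3 \<le> u"
    using assms by (intro that[of "t - 4"]) auto
  obtain v1 T1 where 1: "T = insert v1 T1" "v1 \<notin> T1" "finite T1" "card T1 = Suc (Suc (Suc u))"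
      "\<And>x. x \<in> T1 \<Longrightarrow> v1 < x"
    using Min_split[of T "Suc (Suc (Suc u))"] T u(1) by auto
  obtain v2 T2 where 2: "T1 = insert v2 T2" "v2 \<notin> T2" "finite T2" "card T2 = Suc (Suc u)"
      "\<And>x. x \<in> T2 \<Longrightarrow> v2 < x"
    using Min_split[of T1 "Suc (Suc u)"] 1 by auto
  obtain v3 T3 where 3: "T2 = insert v3 T3" "v3 \<notin> T3" "finite T3" "card T3 = Suc u"
      "\<And>x. x \<in> T3 \<Longrightarrow> v3 < x"
    using Min_split[of T2 "Suc u"] 2 by auto
  obtain v4 T4 where 4: "T3 = insert v4 T4" "v4 \<notin> T4" "finite T4" "card T4 = u"
      "\<And>x. x \<in> T4 \<Longrightarrow> v4 < x"
    using Min_split[of T3 "u"] 3 by auto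
  \<comment> \<open>As \<open>r < t\<close>, at least \<open>r - 3\<close> vertices lie above
    \<open>v3\<close> and \<open>v4\<close>; the same filler \<open>W\<close> completes both
    edges.\<close>
  obtain W where W: "W \<subseteq> T4" "card W = r - 3" "finite W"
    using obtain_subset_with_card_n[of "r - 3" T4] 4 u finite_subset by metis
  have ord: "v1 < v2" "v2 < v3" "v3 < v4" "\<And>x. x \<in> W \<Longrightarrow> v4 < x"
    using 1 2 3 4 W by auto
  have nW: "v1 \<notin> W" "v2 \<notin> W" "v3 \<notin> W" "v4 \<notin> W" using ord by fastforce+
  have "lowest3 (insert v1 (insert v2 (insert v3 W))) v1 v2 v3"
    unfolding lowest3_def using ord by (auto intro: less_trans)
  moreover have "card (insert v1 (insert v2 (insert v3 W))) = r"
    using W nW ord assms by (simp add: card_insert_if)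
  moreover have "insert v1 (insert v2 (insert v3 W)) \<subseteq> T" using 1 2 3 4 W by auto
  ultimately have "v3 \<notin> h v1" using E lowest3_unique by metis
  moreover have "lowest3 (insert v1 (insert v3 (insert v4 W))) v1 v3 v4"
    unfolding lowest3_def using ord by auto
  moreover have "card (insert v1 (insert v3 (insert v4 W))) = r"
    using W nW ord assms by (simp add: card_insert_if)
  moreover have "insert v1 (insert v3 (insert v4 W)) \<subseteq> T" using 1 2 3 4 W by auto
  ultimately show False using E lowest3_unique by metis
qed

section \<open>Existence of rows without large independent sets\<close>

text \<open>When \<open>A\<close> lies entirely below \<open>B\<close>, the triple \<open>v\<close>,
  \<open>b\<close>, \<open>c\<close> can start an edge. Asking for it with arbitrary
  \<open>A\<close> and \<open>B\<close> keeps the union bound simple.\<close>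

definition good_rows :: "nat \<Rightarrow> nat \<Rightarrow> (nat \<Rightarrow> nat set) \<Rightarrow> bool" where
  "good_rows n p h \<longleftrightarrow> (\<forall>A B. A \<subseteq> {..<n} \<longrightarrow> B \<subseteq> {..<n} \<longrightarrow> card A = p \<longrightarrow> card B = p \<longrightarrow>
     (\<exists>v\<in>A. \<exists>b\<in>B. \<exists>c\<in>B. b < c \<and> b \<in> h v \<and> c \<notin> h v))"

text \<open>The rows that provide no witness for \<open>good_rows\<close> on \<open>B\<close>:
  inside \<open>B\<close> they are final segments.\<close>

definition monotone_rows :: "nat \<Rightarrow> nat set \<Rightarrow> nat set set" where
  "monotone_rows n B = {X. X \<subseteq> {..<n} \<and> (\<forall>b\<in>B. \<forall>c\<in>B. b < c \<longrightarrow> b \<in> X \<longrightarrow> c \<in> X)}"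

text \<open>On \<open>B\<close> such a row is determined by a threshold \<open>\<tau> \<le> n\<close>.\<close>

lemma card_monotone_rows:
  assumes "B \<subseteq> {..<n}"
  shows "card (monotone_rows n B) \<le> 2 ^ (n - card B) * (n + 1)"
proof -
  have finB: "finite B" using assms finite_subset by blast
  have "monotone_rows n B \<subseteq> (\<lambda>(Y, \<tau>). Y \<union> {b \<in> B. \<tau> \<le> b}) ` (Pow ({..<n} - B) \<times> {..n})"
  proof
    fix X assume X: "X \<in> monotone_rows n B"
    \<comment> \<open>The value \<open>n\<close> encodes an empty intersection, since all of
      \<open>B\<close> lies below \<open>n\<close>.\<close>
    define \<tau> where "\<tau> = (if X \<inter> B = {} then n else Min (X \<inter> B))"
    have fin: "finite (X \<inter> B)" using finB by simp
    have up: "c \<in> X" if "b \<in> B" "c \<in> B" "b < c" "b \<in> X" for b c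
      using X that unfolding monotone_rows_def by blast
    have "X \<inter> B = {b \<in> B. \<tau> \<le> b}"
    proof (cases "X \<inter> B = {}")
      case True
      then show ?thesis using assms unfolding \<tau>_def by fastforce
    next
      case False
      then have m: "Min (X \<inter> B) \<in> X \<inter> B" using fin Min_in by blast
      have "b \<in> X" if "b \<in> B" "Min (X \<inter> B) \<le> b" for b
        using that m up[of "Min (X \<inter> B)" b] by (metis Int_iff le_neq_implies_less)
      moreover have "Min (X \<inter> B) \<le> b" if "b \<in> X" "b \<in> B" for b
        using that fin by simp
      ultimately show ?thesis using False unfolding \<tau>_def by auto
    qed
    then have "X = (X - B) \<union> {b \<in> B. \<tau> \<le> b}" by blast
    moreover have "X - B \<in> Pow ({..<n} - B)" using X unfolding monotone_rows_def by blast
    moreover have "\<tau> \<le> n"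
    proof (cases "X \<inter> B = {}")
      case False
      then have "Min (X \<inter> B) \<in> X \<inter> B" using fin Min_in by blast
      then show ?thesis using assms False unfolding \<tau>_def by (auto intro: less_imp_le)
    qed (simp add: \<tau>_def)
    ultimately show "X \<in> (\<lambda>(Y, \<tau>). Y \<union> {b \<in> B. \<tau> \<le> b}) ` (Pow ({..<n} - B) \<times> {..n})"
      by (intro image_eqI[of _ _ "(X - B, \<tau>)"]) auto
  qed
  then have "card (monotone_rows n B) \<le>
      card ((\<lambda>(Y, \<tau>). Y \<union> {b \<in> B. \<tau> \<le> b}) ` (Pow ({..<n} - B) \<times> {..n}))"
    by (intro card_mono) auto
  also have "\<dots> \<le> card (Pow ({..<n} - B) \<times> {..n})" by (rule card_image_le) simp
  also have "\<dots> = 2 ^ (n - card B) * (n + 1)"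
    using assms finB by (simp add: card_Pow card_Diff_subset card_cartesian_product)
  finally show ?thesis .
qed

text \<open>Union bound, written as counting. There are at most n^(2p) pairs \<open>(A, B)\<close>,
  and each fails for at most a fraction ((n+1)/2^p)^p of all families of rows. The product is (n^2
  (n+1)/2^p)^p, which is below 1 by \<open>big\<close>.\<close>

lemma ex_good_rows:
  assumes "1 \<le> p" "p \<le> n" and big: "n * n * (n + 1) < 2 ^ p"
  shows "\<exists>h. good_rows n p h"
proof (rule ccontr)
  assume neg: "\<nexists>h. good_rows n p h"
  define H where "H = {..<n} \<rightarrow>\<^sub>E Pow {..<n}"
  define S where "S = {A. A \<subseteq> {..<n} \<and> card A = p}"
  \<comment> \<open>A pair fails when every row indexed by \<open>A\<close> is monotone on
    \<open>B\<close>. The rows are chosen independently, so the failing families form a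
    product.\<close>
  define bad where "bad = (\<lambda>(A, B). PiE {..<n} (\<lambda>v. if v \<in> A then monotone_rows n B else Pow {..<n}))"
  have finS: "finite S" unfolding S_def by (rule finite_subset[of _ "Pow {..<n}"]) auto
  have "card S = n choose p" unfolding S_def using n_subsets[of "{..<n}" p] by simp
  also have "\<dots> \<le> n ^ p" using binomial_le_pow assms by blast
  finally have cS: "card S \<le> n ^ p" .
  have finrow: "finite (monotone_rows n B)" for B
    by (rule finite_subset[of _ "Pow {..<n}"]) (auto simp: monotone_rows_def)
  have fbad: "finite (bad z)" for z
    unfolding bad_def using finrow by (cases z) (auto intro!: finite_PiE)
  have cbad: "card (bad (A, B)) \<le> (2 ^ (n - p) * (n + 1)) ^ p * (2 ^ n) ^ (n - p)"
    if "A \<in> S" "B \<in> S" for A B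
  proof -
    have AB: "A \<subseteq> {..<n}" "card A = p" "B \<subseteq> {..<n}" "card B = p" "finite A"
      using that finite_subset unfolding S_def by auto
    have "card (bad (A, B)) = (\<Prod>v<n. if v \<in> A then card (monotone_rows n B) else 2 ^ n)"
      unfolding bad_def by (simp add: card_PiE card_Pow if_distrib cong: if_cong)
    also have "\<dots> = card (monotone_rows n B) ^ p * (2 ^ n) ^ (n - p)"
    proof -
      have "{..<n} \<inter> A = A" "card ({..<n} - A) = n - p" using AB by (auto simp: card_Diff_subset)
      then show ?thesis using AB by (simp add: prod.If_cases Diff_eq)
    qed
    also have "\<dots> \<le> (2 ^ (n - p) * (n + 1)) ^ p * (2 ^ n) ^ (n - p)"
      using card_monotone_rows[OF AB(3)] AB by (intro mult_right_mono power_mono) auto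
    finally show ?thesis .
  qed
  have "H \<subseteq> (\<Union>z\<in>S \<times> S. bad z)"
  proof
    fix h assume h: "h \<in> H"
    have "\<not> good_rows n p h" using neg by blast
    then obtain A B where *: "A \<subseteq> {..<n}" "B \<subseteq> {..<n}" "card A = p" "card B = p"
      "\<not> (\<exists>v\<in>A. \<exists>b\<in>B. \<exists>c\<in>B. b < c \<and> b \<in> h v \<and> c \<notin> h v)"
      unfolding good_rows_def by auto
    have AB: "A \<in> S" "B \<in> S" using * unfolding S_def by auto
    have "h v \<in> monotone_rows n B" if "v \<in> A" for v
    proof -
      have "h v \<subseteq> {..<n}" using h that *(1) unfolding H_def by blast
      then show ?thesis using *(5) that unfolding monotone_rows_def by blast
    qed
    then have "h \<in> bad (A, B)"
      using h unfolding bad_def H_def by (simp add: PiE_iff)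
    then show "h \<in> (\<Union>z\<in>S \<times> S. bad z)" using AB by blast
  qed
  then have "card H \<le> card (\<Union>z\<in>S \<times> S. bad z)" using finS fbad by (intro card_mono) auto
  also have "\<dots> \<le> (\<Sum>z\<in>S \<times> S. card (bad z))" using finS by (intro card_UN_le) auto
  also have "\<dots> \<le> (\<Sum>z\<in>S \<times> S. (2 ^ (n - p) * (n + 1)) ^ p * (2 ^ n) ^ (n - p))"
    using cbad by (intro sum_mono) auto
  also have "\<dots> = (card S * card S) * ((2 ^ (n - p) * (n + 1)) ^ p * (2 ^ n) ^ (n - p))"
    by (simp add: card_cartesian_product)
  also have "\<dots> \<le> (n ^ p * n ^ p) * ((2 ^ (n - p) * (n + 1)) ^ p * (2 ^ n) ^ (n - p))"
    using cS by (intro mult_right_mono mult_mono) auto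
  \<comment> \<open>Collecting the \<open>p\<close>-th powers lets \<open>big\<close> be applied
    under the exponent.\<close>
  also have "\<dots> = (n * n * (n + 1)) ^ p * ((2 ^ (n - p)) ^ p * (2 ^ n) ^ (n - p))"
    by (simp only: power_mult_distrib mult_ac)
  also have "\<dots> < (2 ^ p) ^ p * ((2 ^ (n - p)) ^ p * (2 ^ n) ^ (n - p))"
    using big assms by (intro mult_strict_right_mono power_strict_mono) auto
  also have "\<dots> = 2 ^ (p * p + (n - p) * p + n * (n - p))"
    by (simp only: power_add flip: power_mult)
  also have "p * p + (n - p) * p + n * (n - p) = n * n"
  proof -
    obtain d where "n = p + d" using assms le_Suc_ex by blast
    then show ?thesis by (simp add: algebra_simps)
  qed
  also have "2 ^ (n * n) = card H" unfolding H_def by (simp add: card_PiE card_Pow power_mult)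
  finally show False by simp
qed

lemma split_lower:
  fixes S :: "nat set"
  assumes "finite S" "card S = a + b"
  shows "\<exists>A B. S = A \<union> B \<and> card A = a \<and> card B = b \<and> (\<forall>x\<in>A. \<forall>y\<in>B. x < y)"
  using assms
proof (induction a arbitrary: S)
  case 0
  then show ?case by (intro exI[of _ "{}"] exI[of _ S]) auto
next
  case (Suc a)
  obtain v T where v: "S = insert v T" "v \<notin> T" "finite T" "card T = a + b" "\<And>x. x \<in> T \<Longrightarrow> v < x"
    using Min_split[of S "a + b"] Suc.prems by auto
  obtain A B where AB: "T = A \<union> B" "card A = a" "card B = b" "\<forall>x\<in>A. \<forall>y\<in>B. x < y"
    using Suc.IH v by blast
  have "card (insert v A) = Suc a" using v AB by (subst card_insert_disjoint) auto
  then show ?case using v AB by (intro exI[of _ "insert v A"] exI[of _ B]) auto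
qed

text \<open>Cut part of \<open>S\<close> into blocks \<open>A\<close>, \<open>B\<close>,
  \<open>W\<close> in increasing order, of sizes \<open>p\<close>, \<open>p\<close>,
  \<open>r - 3\<close>. The witnesses come from \<open>A\<close> and \<open>B\<close>, and adding
  \<open>W\<close> on top leaves the three lowest vertices unchanged.\<close>

lemma good_rows_edge:
  assumes good: "good_rows n p h" and r: "3 \<le> r" and S: "S \<subseteq> {..<n}" "2 * p + r \<le> card S"
  shows "\<exists>e \<in> hedges (row_graph r n h). e \<subseteq> S"
proof -
  obtain S' where S': "S' \<subseteq> S" "card S' = p + (p + (r - 3))" "finite S'"
  proof (rule obtain_subset_with_card_n)
    show "p + (p + (r - 3)) \<le> card S" using S(2) by simp
  qed blast
  obtain A R where A: "S' = A \<union> R" "card A = p" "card R = p + (r - 3)" "\<forall>x\<in>A. \<forall>y\<in>R. x < y"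
    using split_lower[of S' p "p + (r - 3)"] S' by auto
  have "finite R" using S' A by auto
  obtain B W where B: "R = B \<union> W" "card B = p" "card W = r - 3" "\<forall>x\<in>B. \<forall>y\<in>W. x < y"
    using split_lower[OF \<open>finite R\<close> A(3)] by auto
  have "A \<subseteq> {..<n}" "B \<subseteq> {..<n}" using A B S S' by auto
  then obtain v b c where v: "v \<in> A" "b \<in> B" "c \<in> B" "b < c" "b \<in> h v" "c \<notin> h v"
    using good A(2) B(2) unfolding good_rows_def by blast
  define e where "e = insert v (insert b (insert c W))"
  have ord: "v < b" "\<And>x. x \<in> W \<Longrightarrow> c < x" using v A B by auto
  then have "v \<notin> W" "b \<notin> W" "c \<notin> W" using v by fastforce+
  moreover have "finite W" using \<open>finite R\<close> B by simp
  ultimately have "card e = r" unfolding e_def using v ord B r by (simp add: card_insert_if)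
  moreover have "lowest3 e v b c" unfolding lowest3_def e_def using v ord by auto
  moreover have "e \<subseteq> S" unfolding e_def using v A B S' by auto
  ultimately show ?thesis using v S unfolding row_graph_def by auto
qed

text \<open>A color class contains no edge, so it has fewer than \<open>2 * p + r\<close> vertices,
  and \<open>k\<close> such classes cannot cover all \<open>n\<close> vertices.\<close>

lemma chromatic_number_row_graph:
  assumes good: "good_rows n p h" and r: "3 \<le> r" and n: "1 \<le> k" "k * (2 * p + r) \<le> n"
  shows "chromatic_number (row_graph r n h) > k"
proof (rule chromatic_number_gtI[OF r_graph_row_graph])
  show "2 \<le> r" using r by simp
  fix c
  show "\<not> proper_coloring (row_graph r n h) k c"
  proof
    assume c: "proper_coloring (row_graph r n h) k c"
    then have im: "c ` {..<n} \<subseteq> {..<k}" unfolding proper_coloring_def row_graph_def by simp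
    have "card {v \<in> {..<n}. c v = a} < 2 * p + r" for a
    proof (rule ccontr)
      assume "\<not> card {v \<in> {..<n}. c v = a} < 2 * p + r"
      then obtain e where "e \<in> hedges (row_graph r n h)" "e \<subseteq> {v \<in> {..<n}. c v = a}"
        using good_rows_edge[OF good r, of "{v \<in> {..<n}. c v = a}"] by auto
      then have "\<not> monochromatic c e" "\<forall>v\<in>e. c v = a"
        using c unfolding proper_coloring_def by auto
      then show False unfolding monochromatic_def by blast
    qed
    then have less: "card {v \<in> {..<n}. c v = a} \<le> 2 * p + r - 1" for a
      by (metis Suc_leI Suc_le_mono Suc_pred' gr_implies_not0 neq0_conv)
    have "{..<n} = (\<Union>a<k. {v \<in> {..<n}. c v = a})" using im by auto
    then have "n \<le> card (\<Union>a<k. {v \<in> {..<n}. c v = a})" by (metis card_lessThan order_refl)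
    also have "\<dots> \<le> (\<Sum>a<k. card {v \<in> {..<n}. c v = a})" by (rule card_UN_le) simp
    also have "\<dots> \<le> (\<Sum>a<k. 2 * p + r - 1)" using less by (intro sum_mono) auto
    also have "\<dots> = k * (2 * p + r - 1)" by simp
    also have "\<dots> < k * (2 * p + r)" using n(1) r by (intro mult_strict_left_mono) auto
    finally show False using n by simp
  qed
qed

subsection \<open>Graphs without large cliques\<close>

definition clique :: "'a set set \<Rightarrow> 'a set \<Rightarrow> bool" where
  "clique E C \<longleftrightarrow> (\<forall>x\<in>C. \<forall>y\<in>C. x \<noteq> y \<longrightarrow> {x, y} \<in> E)"

definition indep :: "'a set set \<Rightarrow> 'a set \<Rightarrow> bool" where
  "indep E I \<longleftrightarrow> (\<forall>x\<in>I. \<forall>y\<in>I. x \<noteq> y \<longrightarrow> {x, y} \<notin> E)"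

definition nbrs :: "'a set set \<Rightarrow> 'a set \<Rightarrow> 'a \<Rightarrow> 'a set" where
  "nbrs E V v = {w \<in> V. w \<noteq> v \<and> {v, w} \<in> E}"

text \<open>\<open>E\<close> stays fixed while \<open>V\<close> shrinks: only pairs inside
  \<open>V\<close> count, so this is colorability of the subgraph induced on
  \<open>V\<close>.\<close>

definition colorable :: "'a set set \<Rightarrow> 'a set \<Rightarrow> nat \<Rightarrow> bool" where
  "colorable E V k \<longleftrightarrow> (\<exists>c :: 'a \<Rightarrow> nat. (\<forall>x\<in>V. c x < k) \<and>
     (\<forall>x\<in>V. \<forall>y\<in>V. x \<noteq> y \<longrightarrow> {x, y} \<in> E \<longrightarrow> c x \<noteq> c y))"

text \<open>Choosing a vertex and deleting it with its neighbors costs at most \<open>d\<close>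
  vertices, which allows \<open>a\<close> choices.\<close>

lemma greedy_indep:
  assumes "finite V" "\<And>v. v \<in> V \<Longrightarrow> card (nbrs E V v) < d" "1 \<le> d" "a * d \<le> card V"
  shows "\<exists>I\<subseteq>V. card I = a \<and> indep E I"
  using assms
proof (induction a arbitrary: V)
  case 0
  then show ?case by (intro exI[of _ "{}"]) (auto simp: indep_def)
next
  case (Suc a)
  show ?case
  proof (cases "V = {}")
    case True
    then show ?thesis using Suc.prems(3,4) by simp
  next
    case False
    then obtain v where v: "v \<in> V" by blast
    define W where "W = V - insert v (nbrs E V v)"
    have finN: "finite (nbrs E V v)" using Suc.prems(1) unfolding nbrs_def by simp
    have "card (insert v (nbrs E V v)) \<le> d"
      using Suc.prems(2)[OF v] finN by (simp add: card_insert_if)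
    moreover have "card V - card (insert v (nbrs E V v)) \<le> card W"
      unfolding W_def by (rule diff_card_le_card_Diff) (use finN in simp)
    ultimately have "a * d \<le> card W" using Suc.prems(4) by simp
    moreover have "card (nbrs E W w) < d" if "w \<in> W" for w
    proof -
      have "nbrs E W w \<subseteq> nbrs E V w" unfolding nbrs_def W_def by auto
      then have "card (nbrs E W w) \<le> card (nbrs E V w)"
        using Suc.prems(1) by (intro card_mono) (auto simp: nbrs_def)
      then show ?thesis using Suc.prems(2)[of w] that unfolding W_def by auto
    qed
    moreover have "finite W" using Suc.prems(1) W_def by simp
    ultimately obtain I where I: "I \<subseteq> W" "card I = a" "indep E I" using Suc.IH Suc.prems(3) by blast
    have "finite I" using I(1) \<open>finite W\<close> finite_subset by blast
    moreover have "v \<notin> I" using I(1) unfolding W_def by blast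
    ultimately have "card (insert v I) = Suc a" using I by simp
    moreover have "{v, x} \<notin> E" if "x \<in> I" for x
      using that I(1) unfolding W_def nbrs_def by auto
    then have "indep E (insert v I)"
      using I(3) unfolding indep_def by (auto simp: insert_commute)
    moreover have "insert v I \<subseteq> V" using I(1) v unfolding W_def by blast
    ultimately show ?thesis by blast
  qed
qed

text \<open>Ramsey argument by induction on \<open>s\<close>. A vertex with at least
  \<open>a ^ s\<close> neighbors lowers the forbidden clique size by one inside its neighborhood; if
  there is none, the greedy choice with \<open>d = a ^ s\<close> succeeds.\<close>

lemma large_indep:
  assumes "finite V" "a ^ s \<le> card V" "1 \<le> a" "\<And>C. C \<subseteq> V \<Longrightarrow> clique E C \<Longrightarrow> card C \<noteq> Suc s"
  shows "\<exists>I\<subseteq>V. card I = a \<and> indep E I"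
  using assms
proof (induction s arbitrary: V)
  case 0
  then obtain v where "v \<in> V" by fastforce
  moreover have "clique E {v}" unfolding clique_def by simp
  ultimately show ?case using 0(4)[of "{v}"] by simp
next
  case (Suc s)
  show ?case
  proof (cases "\<exists>v\<in>V. a ^ s \<le> card (nbrs E V v)")
    case True
    then obtain v where v: "v \<in> V" "a ^ s \<le> card (nbrs E V v)" by blast
    have fin: "finite (nbrs E V v)" using Suc.prems(1) unfolding nbrs_def by simp
    have "card C \<noteq> Suc s" if C: "C \<subseteq> nbrs E V v" "clique E C" for C
    proof
      assume "card C = Suc s"
      moreover have "v \<notin> C" "finite C" using C(1) fin finite_subset unfolding nbrs_def by auto
      ultimately have "card (insert v C) = Suc (Suc s)" by simp
      moreover have "{v, x} \<in> E" if "x \<in> C" for x using that C(1) unfolding nbrs_def by blast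
      then have "clique E (insert v C)"
        using C(2) unfolding clique_def by (auto simp: insert_commute)
      moreover have "insert v C \<subseteq> V" using C(1) v unfolding nbrs_def by blast
      ultimately show False using Suc.prems(4) by blast
    qed
    then obtain I where "I \<subseteq> nbrs E V v" "card I = a" "indep E I"
      using Suc.IH[OF fin v(2) Suc.prems(3)] by blast
    then show ?thesis unfolding nbrs_def by blast
  next
    case False
    then have "card (nbrs E V v) < a ^ s" if "v \<in> V" for v using that by auto
    then show ?thesis using greedy_indep[of V E "a ^ s" a] Suc.prems by simp
  qed
qed

text \<open>While at least \<open>a ^ s\<close> vertices remain, an independent set of size
  \<open>a\<close> is split off and given one new color. The fewer than \<open>a ^ s\<close>
  vertices left at the end get distinct colors.\<close>

lemma colorable_no_clique:
  assumes "finite V" "1 \<le> a" "\<And>C. C \<subseteq> V \<Longrightarrow> clique E C \<Longrightarrow> card C \<noteq> Suc s"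
  shows "colorable E V (card V div a + a ^ s)"
  using assms
proof (induction "card V" arbitrary: V rule: less_induct)
  case less
  show ?case
  proof (cases "a ^ s \<le> card V")
    case True
    then obtain I where I: "I \<subseteq> V" "card I = a" "indep E I"
      using large_indep[of V a s E] less.prems by blast
    have finI: "finite I" using I(1) less.prems(1) finite_subset by blast
    have aV: "a \<le> card V" using I card_mono[OF less.prems(1)] by metis
    have cW: "card (V - I) = card V - a" using I finI by (simp add: card_Diff_subset)
    have "colorable E (V - I) (card (V - I) div a + a ^ s)"
      using less.hyps[of "V - I"] less.prems cW aV by auto
    \<comment> \<open>Removing \<open>a\<close> vertices lowers the quotient by exactly one, which
      pays for the color of \<open>I\<close>.\<close>
    moreover have "card V div a = Suc ((card V - a) div a)"
      using aV less.prems(2) by (simp add: le_div_geq)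
    ultimately have "colorable E (V - I) (card V div a + a ^ s - 1)" using cW by simp
    then obtain c where c: "\<And>x. x \<in> V - I \<Longrightarrow> c x < card V div a + a ^ s - 1"
      "\<And>x y. x \<in> V - I \<Longrightarrow> y \<in> V - I \<Longrightarrow> x \<noteq> y \<Longrightarrow> {x, y} \<in> E \<Longrightarrow> c x \<noteq> c y"
      unfolding colorable_def by blast
    have pos: "0 < card V div a + a ^ s" using less.prems(2) by simp
    define c' where "c' x = (if x \<in> I then card V div a + a ^ s - 1 else c x)" for x
    have lt: "c' x < card V div a + a ^ s" if "x \<in> V" for x
      using c(1)[of x] that pos unfolding c'_def by auto
    have ne: "c' x \<noteq> c' y" if xy: "x \<in> V" "y \<in> V" "x \<noteq> y" "{x, y} \<in> E" for x y
    proof -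
      have "\<not> (x \<in> I \<and> y \<in> I)" using I(3) xy unfolding indep_def by blast
      then show ?thesis
        using xy c(1)[of x] c(1)[of y] c(2)[of x y] unfolding c'_def by auto
    qed
    show ?thesis unfolding colorable_def using lt ne by blast
  next
    case False
    obtain c where c: "inj_on c V" "c ` V = {..<card V}"
      using ex_bij_betw_finite_nat[OF less.prems(1)] unfolding bij_betw_def
      by (metis atLeast0LessThan)
    have "c x < card V div a + a ^ s" if "x \<in> V" for x
    proof -
      have "c x < card V" using that c(2) by blast
      then show ?thesis using False by simp
    qed
    moreover have "c x \<noteq> c y" if "x \<in> V" "y \<in> V" "x \<noteq> y" for x y
      using that c(1) by (auto dest: inj_onD)
    ultimately show ?thesis unfolding colorable_def by blast
  qed
qed

section \<open>Minimum degree and edge counting\<close>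

text \<open>Delete vertices as long as the rest is not \<open>k\<close>-colorable. At the end, a
  vertex with fewer than \<open>k\<close> neighbors would have a free color that extends a coloring
  of the rest.\<close>

lemma ex_high_degree_subgraph:
  assumes "finite V" "\<not> colorable E V k"
  shows "\<exists>U\<subseteq>V. \<not> colorable E U k \<and> (\<forall>v\<in>U. k \<le> card (nbrs E U v))"
  using assms
proof (induction "card V" arbitrary: V rule: less_induct)
  case less
  show ?case
  proof (cases "\<exists>v\<in>V. \<not> colorable E (V - {v}) k")
    case True
    then obtain v where v: "v \<in> V" "\<not> colorable E (V - {v}) k" by blast
    then have "card (V - {v}) < card V" using less.prems(1) by (meson card_Diff1_less)
    then obtain U where "U \<subseteq> V - {v}" "\<not> colorable E U k" "\<forall>v\<in>U. k \<le> card (nbrs E U v)"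
      using less.hyps[of "V - {v}"] less.prems v by auto
    then show ?thesis by blast
  next
    case False
    have "k \<le> card (nbrs E V v)" if v: "v \<in> V" for v
    proof (rule ccontr)
      assume small: "\<not> k \<le> card (nbrs E V v)"
      have "colorable E (V - {v}) k" using False v by blast
      then obtain c where c: "\<And>x. x \<in> V - {v} \<Longrightarrow> c x < k"
        "\<And>x y. x \<in> V - {v} \<Longrightarrow> y \<in> V - {v} \<Longrightarrow> x \<noteq> y \<Longrightarrow> {x, y} \<in> E \<Longrightarrow> c x \<noteq> c y"
        unfolding colorable_def by blast
      have fin: "finite (nbrs E V v)" using less.prems(1) unfolding nbrs_def by simp
      have "card (c ` nbrs E V v) < card {..<k}" using small card_image_le[OF fin, of c] by simp
      then have "\<not> {..<k} \<subseteq> c ` nbrs E V v"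
        using card_mono[OF finite_imageI[OF fin], of "{..<k}" c] by linarith
      then obtain j where j: "j < k" "j \<notin> c ` nbrs E V v" by blast
      have cj: "c w \<noteq> j" if "w \<in> V" "w \<noteq> v" "{v, w} \<in> E" for w
        using that j(2) unfolding nbrs_def by blast
      have "colorable E V k"
        unfolding colorable_def
      proof (intro exI[of _ "c(v := j)"] conjI ballI impI)
        fix x assume "x \<in> V"
        then show "(c(v := j)) x < k" using c(1) j by simp
      next
        fix x y assume xy: "x \<in> V" "y \<in> V" "x \<noteq> y" "{x, y} \<in> E"
        then have "{y, x} \<in> E" by (simp add: insert_commute)
        then show "(c(v := j)) x \<noteq> (c(v := j)) y"
          using xy c(2)[of x y] cj[of x] cj[of y] by auto
      qed
      then show False using less.prems by blast
    qed
    then show ?thesis using less.prems by blast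
  qed
qed

text \<open>Handshake count: an edge contributes at most its two endpoints.\<close>

lemma degree_sum_le:
  assumes "finite U" "finite E" "\<And>e. e \<in> E \<Longrightarrow> card e = 2" "\<And>v. v \<in> U \<Longrightarrow> k \<le> card (nbrs E U v)"
  shows "card U * k \<le> 2 * card E"
proof -
  have deg: "k \<le> card {e \<in> E. v \<in> e}" if v: "v \<in> U" for v
  proof -
    have "inj_on (\<lambda>w. {v, w}) (nbrs E U v)"
      by (auto simp: inj_on_def nbrs_def doubleton_eq_iff)
    then have "card (nbrs E U v) = card ((\<lambda>w. {v, w}) ` nbrs E U v)" by (simp add: card_image)
    also have "\<dots> \<le> card {e \<in> E. v \<in> e}"
      using assms(2) by (intro card_mono) (auto simp: nbrs_def)
    finally show ?thesis using assms(4)[OF v] by simp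
  qed
  have "card U * k = (\<Sum>v\<in>U. k)" by simp
  also have "\<dots> \<le> (\<Sum>v\<in>U. card {e \<in> E. v \<in> e})" using deg by (rule sum_mono)
  also have "\<dots> = (\<Sum>v\<in>U. \<Sum>e\<in>E. of_bool (v \<in> e))"
    using assms(2) by (simp add: Collect_conj_eq)
  also have "\<dots> = (\<Sum>e\<in>E. \<Sum>v\<in>U. of_bool (v \<in> e))" by (rule sum.swap)
  also have "\<dots> \<le> (\<Sum>e\<in>E. 2)"
  proof (rule sum_mono)
    fix e assume "e \<in> E"
    then have e: "card e = 2" "finite e" using assms(3) card.infinite by fastforce+
    have "(\<Sum>v\<in>U. of_bool (v \<in> e)) = card (U \<inter> e)" using assms(1) by simp
    also have "\<dots> \<le> card e" using e by (intro card_mono) auto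
    finally show "(\<Sum>v\<in>U. of_bool (v \<in> e)) \<le> (2::nat)" using e by simp
  qed
  finally show ?thesis by simp
qed

lemma contains_copy_of_clique:
  assumes "C \<subseteq> hverts G" "clique (hedges G) C" "card C = s" "finite C"
  shows "contains_copy G (complete_r_graph 2 s)"
proof -
  obtain f where f: "bij_betw f {..<s} C"
    using ex_bij_betw_nat_finite[OF assms(4)] assms(3) by (auto simp: atLeast0LessThan)
  have "f ` e \<in> hedges G" if e: "e \<subseteq> {..<s}" "card e = 2" for e
  proof -
    obtain i j where ij: "e = {i, j}" "i \<noteq> j" using e(2) by (auto simp: card_2_iff)
    then have "f i \<noteq> f j" "f i \<in> C" "f j \<in> C"
      using f e(1) unfolding bij_betw_def by (auto dest: inj_onD)
    then show ?thesis using assms(2) ij unfolding clique_def by auto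
  qed
  then show ?thesis
    using f assms(1) unfolding contains_copy_def complete_r_graph_def bij_betw_def by auto
qed

lemma proper_coloring_graph_iff:
  assumes "r_graph 2 G"
  shows "(\<exists>c. proper_coloring G k c) \<longleftrightarrow> colorable (hedges G) (hverts G) k"
proof
  assume "\<exists>c. proper_coloring G k c"
  then obtain c where c: "c ` hverts G \<subseteq> {..<k}" "\<And>e. e \<in> hedges G \<Longrightarrow> \<not> monochromatic c e"
    unfolding proper_coloring_def by blast
  have "c x \<noteq> c y" if "{x, y} \<in> hedges G" for x y
    using c(2)[OF that] unfolding monochromatic_def by auto
  then show "colorable (hedges G) (hverts G) k" using c(1) unfolding colorable_def by blast
next
  assume "colorable (hedges G) (hverts G) k"
  then obtain c where c: "\<And>x. x \<in> hverts G \<Longrightarrow> c x < k"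
    "\<And>x y. x \<in> hverts G \<Longrightarrow> y \<in> hverts G \<Longrightarrow> x \<noteq> y \<Longrightarrow> {x, y} \<in> hedges G \<Longrightarrow> c x \<noteq> c y"
    unfolding colorable_def by blast
  have "\<not> monochromatic c e" if e: "e \<in> hedges G" for e
  proof -
    have "card e = 2" "e \<subseteq> hverts G" using e assms unfolding r_graph_def by auto
    then obtain x y where "e = {x, y}" "x \<noteq> y" "x \<in> hverts G" "y \<in> hverts G"
      by (auto simp: card_2_iff)
    then show ?thesis using c(2)[of x y] e unfolding monochromatic_def by auto
  qed
  then show "\<exists>c. proper_coloring G k c" using c(1) unfolding proper_coloring_def by blast
qed

text \<open>Here \<open>u\<close> is the order of a non-\<open>k\<close>-colorable induced subgraph
  of minimum degree at least \<open>k\<close>. The degrees bound it from above, and the Ramsey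
  coloring must use more than \<open>k\<close> colors. The parameter \<open>a\<close> is left free
  for later optimization.\<close>

lemma edges_of_clique_free_graph:
  assumes G: "r_graph 2 G" and free: "\<not> contains_copy G (complete_r_graph 2 (Suc s))"
    and chi: "chromatic_number G > k" and a: "1 \<le> a"
  shows "\<exists>u. u * k \<le> 2 * card (hedges G) \<and> k < u div a + a ^ s"
proof -
  define V where "V = hverts G"
  define E where "E = hedges G"
  have fin: "finite V" "finite E" and E: "\<And>e. e \<in> E \<Longrightarrow> card e = 2"
    using G finite_hedges[OF G] unfolding r_graph_def V_def E_def by auto
  have "\<not> colorable E V k"
    using chromatic_number_gtD[OF chi] proper_coloring_graph_iff[OF G] unfolding V_def E_def by blast
  then obtain U where U: "U \<subseteq> V" "\<not> colorable E U k" "\<forall>v\<in>U. k \<le> card (nbrs E U v)"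
    using ex_high_degree_subgraph[OF fin(1)] by blast
  have finU: "finite U" using U(1) fin(1) finite_subset by blast
  have "card U * k \<le> 2 * card E" using degree_sum_le[OF finU fin(2) E] U(3) by blast
  moreover have "card C \<noteq> Suc s" if "C \<subseteq> U" "clique E C" for C
    using contains_copy_of_clique[of C G "Suc s"] free that U(1) finU finite_subset
    unfolding V_def E_def by blast
  then have col: "colorable E U (card U div a + a ^ s)" by (rule colorable_no_clique[OF finU a])
  have "k < card U div a + a ^ s"
  proof (rule ccontr)
    assume "\<not> k < card U div a + a ^ s"
    then have "colorable E U k" using col unfolding colorable_def by (meson leI less_le_trans)
    then show False using U(2) by blast
  qed
  ultimately show ?thesis unfolding E_def by blast
qed

subsection \<open>Shift graphs\<close>

text \<open>Triangle-free graphs of unbounded chromatic number, the witnesses needed for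
  \<open>min_edges_attained\<close>. Pairs are encoded because \<open>min_edges\<close> ranges over
  vertices in \<open>nat\<close>; pairs that are not increasing are isolated.\<close>

definition shift_graph :: "nat \<Rightarrow> nat hypergraph" where
  "shift_graph n = (prod_encode ` ({..<n} \<times> {..<n}),
     {{prod_encode (i, j), prod_encode (j, l)} | i j l. i < j \<and> j < l \<and> l < n})"

lemma r_graph_shift_graph: "r_graph 2 (shift_graph n)"
  unfolding r_graph_def shift_graph_def by auto

lemma shift_graph_edge_iff:
  "{prod_encode (a, b), prod_encode (c, d)} \<in> hedges (shift_graph n) \<longleftrightarrow>
     (a < b \<and> b = c \<and> c < d \<and> d < n) \<or> (c < d \<and> d = a \<and> a < b \<and> b < n)"
  unfolding shift_graph_def by (auto simp: doubleton_eq_iff)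

text \<open>Adjacent pairs have different first entries. In a triangle ordered by first entries, the
  second entry of the lowest pair would equal the first entries of both others.\<close>

lemma shift_graph_free:
  assumes "3 \<le> s"
  shows "\<not> contains_copy (shift_graph n) (complete_r_graph 2 s)"
proof
  assume "contains_copy (shift_graph n) (complete_r_graph 2 s)"
  then obtain f where copy: "\<forall>e\<in>hedges (complete_r_graph 2 s). f ` e \<in> hedges (shift_graph n)"
    unfolding contains_copy_def by blast
  have f: "f ` e \<in> hedges (shift_graph n)" if "e \<subseteq> {..<s}" "card e = 2" for e
    using copy that by (simp add: complete_r_graph_def)
  have edge: "{f 0, f 1} \<in> hedges (shift_graph n)" "{f 1, f 2} \<in> hedges (shift_graph n)"
    "{f 0, f 2} \<in> hedges (shift_graph n)"
    using f[of "{0, 1}"] f[of "{1, 2}"] f[of "{0, 2}"] assms by auto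
  obtain a b c d a' b' where "f 0 = prod_encode (a, b)" "f 1 = prod_encode (c, d)"
    "f 2 = prod_encode (a', b')"
    by (metis prod_decode_inverse surj_pair)
  then show False using edge by (auto simp: shift_graph_edge_iff)
qed

text \<open>The colors used on pairs \<open>(i, j)\<close> with fixed first entry \<open>i\<close> form a set that
  determines \<open>i\<close>, so there are at most \<open>2 ^ k\<close> values of \<open>i\<close>.\<close>

lemma chromatic_number_shift_graph: "chromatic_number (shift_graph (Suc (2 ^ k))) > k"
proof (rule chromatic_number_gtI[OF r_graph_shift_graph])
  fix c
  define n where "n = Suc (2 ^ k)"
  show "\<not> proper_coloring (shift_graph (Suc (2 ^ k))) k c"
  proof
    assume "proper_coloring (shift_graph (Suc (2 ^ k))) k c"
    then have c: "c ` hverts (shift_graph n) \<subseteq> {..<k}"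
      "\<And>e. e \<in> hedges (shift_graph n) \<Longrightarrow> \<not> monochromatic c e"
      unfolding proper_coloring_def n_def by auto
    have ne: "c (prod_encode (i, j)) \<noteq> c (prod_encode (j, l))" if "i < j" "j < l" "l < n" for i j l
    proof -
      have "{prod_encode (i, j), prod_encode (j, l)} \<in> hedges (shift_graph n)"
        using that by (simp add: shift_graph_edge_iff)
      then show ?thesis using c(2) unfolding monochromatic_def by fastforce
    qed
    define A where "A i = (\<lambda>j. c (prod_encode (i, j))) ` {i<..<n}" for i
    \<comment> \<open>The color of \<open>(i, j)\<close> lies in \<open>A i\<close> but not in
      \<open>A j\<close>, since \<open>(i, j)\<close> is adjacent to every
      \<open>(j, l)\<close>.\<close>
    have neq: "A i \<noteq> A j" if "i < j" "j < n" for i j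
    proof -
      have "c (prod_encode (i, j)) \<in> A i" using that unfolding A_def by auto
      moreover have "c (prod_encode (i, j)) \<notin> A j" using ne that unfolding A_def by auto
      ultimately show ?thesis by blast
    qed
    have "inj_on A {..<n}"
      by (rule inj_onI) (metis lessThan_iff linorder_neqE_nat neq)
    moreover have "c (prod_encode (i, j)) < k" if "i < j" "j < n" for i j
      using c(1) that unfolding shift_graph_def by (auto simp: image_subset_iff)
    then have "A ` {..<n} \<subseteq> Pow {..<k}" unfolding A_def by auto
    ultimately have "card {..<n} \<le> card (Pow {..<k})" by (intro card_inj_on_le) auto
    then show False unfolding n_def by (simp add: card_Pow)
  qed
qed simp

subsection \<open>Asymptotics\<close>

text \<open>If there were few edges, taking \<open>a\<close> of order k^\<epsilon> would make both
  terms of \<open>u div a + a ^ d\<close> at most k/2, contradicting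
  \<open>k < u div a + a ^ d\<close>.\<close>

lemma min_edges_clique_gt:
  fixes s :: nat
  assumes s: "3 \<le> s"
  shows "\<exists>\<epsilon>::real. \<epsilon> > 0 \<and> (\<forall>\<^sub>F k in sequentially.
    real (min_edges 2 (complete_r_graph 2 s) k) > real k powr (2 + \<epsilon>))"
proof -
  define d where "d = s - 1"
  have d: "1 \<le> d" "s = Suc d" using s unfolding d_def by auto
  \<comment> \<open>Chosen so that \<open>a ^ d\<close> has order k^(1/2).\<close>
  define \<epsilon> :: real where "\<epsilon> = 1 / (2 * real d)"
  have \<epsilon>: "\<epsilon> > 0" using d unfolding \<epsilon>_def by simp
  \<comment> \<open>Absorbs the constants in \<open>2 * a ^ d \<le> k\<close>.\<close>
  have ev: "\<forall>\<^sub>F k in sequentially. 2 * 5 ^ d \<le> real k powr (1 / 2)"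
  proof -
    have "filterlim (\<lambda>k::nat. real k powr (1 / 2)) at_top sequentially" by real_asymp
    then show ?thesis unfolding filterlim_at_top by blast
  qed
  have "\<forall>\<^sub>F k in sequentially.
    real (min_edges 2 (complete_r_graph 2 s) k) > real k powr (2 + \<epsilon>)"
    using ev eventually_ge_at_top[of 1]
  proof eventually_elim
    case (elim k)
    define m where "m = min_edges 2 (complete_r_graph 2 s) k"
    show ?case
    proof (rule ccontr)
      assume "\<not> ?case"
      then have m: "real m \<le> real k powr (2 + \<epsilon>)" unfolding m_def by simp
      define x where "x = real k powr \<epsilon>"
      have x1: "1 \<le> x" unfolding x_def using elim \<epsilon> by (simp add: ge_one_powr_ge_zero)
      \<comment> \<open>The few edges will give \<open>u \<le> 2 * x * k\<close>, so division by
        \<open>a \<ge> 4 * x\<close> leaves k/2. Rounding up adds at most \<open>1 \<le> x\<close>,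
        hence the 5.\<close>
      define a where "a = nat \<lceil>4 * x\<rceil>"
      have a: "4 * x \<le> real a" "real a \<le> 5 * x" "1 \<le> a" unfolding a_def using x1 by linarith+
      obtain G :: "nat hypergraph" where G: "r_graph 2 G"
        "\<not> contains_copy G (complete_r_graph 2 s)" "chromatic_number G > k" "card (hedges G) = m"
        using min_edges_attained[OF r_graph_shift_graph shift_graph_free[OF s]
            chromatic_number_shift_graph] unfolding m_def by metis
      obtain u where u: "u * k \<le> 2 * m" "k < u div a + a ^ d"
        using edges_of_clique_free_graph[of G d k a] G a(3) d by auto
      have "real a ^ d \<le> (5 * x) ^ d" using a by (intro power_mono) auto
      also have "\<dots> = 5 ^ d * x ^ d" by (simp add: power_mult_distrib)
      also have "x ^ d = real k powr (\<epsilon> * real d)"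
        unfolding x_def using elim by (simp add: powr_powr powr_realpow[symmetric])
      also have "\<epsilon> * real d = 1 / 2" using d unfolding \<epsilon>_def by simp
      finally have "2 * real a ^ d \<le> 2 * 5 ^ d * real k powr (1 / 2)" by simp
      also have "\<dots> \<le> real k powr (1 / 2) * real k powr (1 / 2)"
        using elim by (intro mult_right_mono) auto
      also have "\<dots> = real k" using elim by (simp flip: powr_add)
      finally have half1: "real a ^ d \<le> real k / 2" by simp
      have "real u * real k \<le> 2 * real m" using u(1) by (metis of_nat_le_iff of_nat_mult of_nat_numeral)
      also have "\<dots> \<le> 2 * (real k powr 2 * x)" using m unfolding x_def by (simp add: powr_add)
      also have "real k powr 2 = real k * real k" using elim by (simp add: power2_eq_square)
      finally have "real u * real k \<le> (2 * x * real k) * real k" by (simp add: mult_ac)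
      then have "real u \<le> 2 * x * real k" using elim by simp
      also have "\<dots> \<le> real a / 2 * real k" using a by (intro mult_right_mono) auto
      finally have "real u / real a \<le> real k / 2" using a(3) by (simp add: field_simps)
      then have "real (u div a) \<le> real k / 2" using of_nat_div_le_of_nat[of u a, where ?'a = real] by linarith
      then have "real (u div a + a ^ d) \<le> real k" using half1 by simp
      then show False using u(2) by linarith
    qed
  qed
  then show ?thesis using \<epsilon> by blast
qed

section \<open>Edge bounds for complete \<open>r\<close>-graphs with
  \<open>r \<ge> 3\<close>\<close>

text \<open>A row graph on \<open>k * (2 * p + r)\<close> vertices, its edges bounded crudely by the
  number of all \<open>r\<close>-subsets.\<close>

lemma ex_free_hypergraph:
  assumes r: "3 \<le> r" "r < t" and k: "2 \<le> k" and p: "1 \<le> p" "real k ^ 8 \<le> 2 ^ p" "2 * p + r \<le> k"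
  shows "\<exists>G :: nat hypergraph. r_graph r G \<and> \<not> contains_copy G (complete_r_graph r t) \<and>
    chromatic_number G > k \<and> card (hedges G) \<le> (k * (2 * p + r)) ^ r"
proof -
  define n where "n = k * (2 * p + r)"
  have nk: "n \<le> k * k" using p unfolding n_def by (intro mult_left_mono) auto
  have "1 * (2 * p + r) \<le> n" unfolding n_def using k by (intro mult_right_mono) auto
  then have pn: "p \<le> n" "r \<le> n" by auto
  \<comment> \<open>Source of the exponent 8: with \<open>n \<le> k * k\<close> the product is at
    most \<open>k ^ 7 < k ^ 8\<close>.\<close>
  have "n * n * (n + 1) \<le> (k * k) * (k * k) * (k * k + 1)"
    using nk by (intro mult_mono add_mono) auto
  also have "\<dots> \<le> (k * k) * (k * k) * (k * k * k)"
  proof -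
    have "k * k + 1 \<le> k * k * 2" using k by simp
    also have "\<dots> \<le> k * k * k" using k by (intro mult_left_mono) auto
    finally show ?thesis by (intro mult_left_mono) auto
  qed
  also have "\<dots> < k ^ 8"
  proof -
    have "(k * k) * (k * k) * (k * k * k) * 1 < (k * k) * (k * k) * (k * k * k) * k"
      using k by (intro mult_strict_left_mono) auto
    then show ?thesis by (simp add: eval_nat_numeral mult_ac)
  qed
  also have "k ^ 8 \<le> 2 ^ p"
    using p(2) by (metis of_nat_le_iff of_nat_numeral of_nat_power)
  finally obtain h where h: "good_rows n p h" using ex_good_rows p(1) pn(1) by blast
  have "card (hedges (row_graph r n h)) \<le> card {e. e \<subseteq> {..<n} \<and> card e = r}"
    unfolding row_graph_def by (intro card_mono) (auto intro: finite_subset[of _ "Pow {..<n}"])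
  also have "\<dots> \<le> n ^ r" using n_subsets[of "{..<n}" r] binomial_le_pow[OF pn(2)] by simp
  finally show ?thesis
    using r_graph_row_graph row_graph_free[OF r] chromatic_number_row_graph[OF h r(1)] k
    unfolding n_def by (intro exI[of _ "row_graph r n h"]) (auto simp: n_def)
qed

lemma min_edges_complete_bounds:
  assumes r: "3 \<le> r" "r < t" and k: "2 \<le> k"
    and small: "16 * log 2 (real k) + 2 + real r \<le> real k"
  shows "(real k / 4) ^ r \<le> real (min_edges r (complete_r_graph r t) k)"
    and "real (min_edges r (complete_r_graph r t) k)
      \<le> (real k * (16 * log 2 (real k) + 2 + real r)) ^ r"
proof -
  define L where "L = log 2 (real k)"
  have L: "1 \<le> L" unfolding L_def using k by (simp add: le_log_iff)
  \<comment> \<open>The least integer with \<open>k ^ 8 \<le> 2 ^ p\<close>; rounding accounts for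
    the 2 in \<open>16 * L + 2 + r\<close>.\<close>
  define p where "p = nat \<lceil>8 * L\<rceil>"
  have p: "1 \<le> p" "8 * L \<le> real p" "real p \<le> 8 * L + 1" unfolding p_def using L by linarith+
  have "real k ^ 8 = (2 powr L) ^ 8" using k unfolding L_def by simp
  also have "\<dots> = 2 powr (8 * L)" using powr_realpow[of "2 powr L" 8] by (simp add: powr_powr mult.commute)
  also have "\<dots> \<le> 2 powr real p" using p by simp
  finally have kp: "real k ^ 8 \<le> 2 ^ p" by (simp add: powr_realpow)
  have pr: "real (2 * p + r) \<le> 16 * L + 2 + real r" using p by simp
  then have "2 * p + r \<le> k" using small unfolding L_def by linarith
  then obtain G :: "nat hypergraph" where G: "r_graph r G"
    "\<not> contains_copy G (complete_r_graph r t)" "chromatic_number G > k"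
    "card (hedges G) \<le> (k * (2 * p + r)) ^ r"
    using ex_free_hypergraph[OF r k p(1) kp] by blast
  have "min_edges r (complete_r_graph r t) k \<le> (k * (2 * p + r)) ^ r"
    using min_edges_le[OF G(1-3)] G(4) by simp
  then have "real (min_edges r (complete_r_graph r t) k) \<le> (real k * real (2 * p + r)) ^ r"
    by (metis of_nat_le_iff of_nat_mult of_nat_power)
  also have "\<dots> \<le> (real k * (16 * L + 2 + real r)) ^ r"
    using pr by (intro power_mono mult_left_mono) auto
  finally show "real (min_edges r (complete_r_graph r t) k)
      \<le> (real k * (16 * log 2 (real k) + 2 + real r)) ^ r" unfolding L_def .
  obtain G' :: "nat hypergraph" where G': "r_graph r G'" "chromatic_number G' > k"
    "card (hedges G') = min_edges r (complete_r_graph r t) k"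
    using min_edges_attained[OF G(1-3)] by metis
  \<comment> \<open>Otherwise the recoloring argument with \<open>q = k div 2\<close> would use at
    most \<open>k\<close> colors.\<close>
  have "(k div 2) ^ r < card (hedges G')"
  proof (rule ccontr)
    assume "\<not> (k div 2) ^ r < card (hedges G')"
    moreover have "2 \<le> r" "1 \<le> k div 2" using r k by auto
    ultimately obtain c where "proper_coloring G' (2 * (k div 2)) c"
      using proper_coloring_of_few_edges[OF G'(1)] by (meson not_less)
    then have "proper_coloring G' k c" by (rule proper_coloring_mono) simp
    then show False using chromatic_number_gtD[OF G'(2)] by blast
  qed
  then have "real (k div 2) ^ r \<le> real (min_edges r (complete_r_graph r t) k)"
    unfolding G'(3) by (metis less_imp_le of_nat_le_iff of_nat_power)
  \<comment> \<open>The 4 instead of 2 absorbs the rounding in \<open>k div 2\<close>.\<close>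
  moreover have "real k / 4 \<le> real (k div 2)" using k by linarith
  then have "(real k / 4) ^ r \<le> real (k div 2) ^ r" by (intro power_mono) auto
  ultimately show "(real k / 4) ^ r \<le> real (min_edges r (complete_r_graph r t) k)" by linarith
qed

text \<open>The exponent error \<delta> is solved for by taking logarithms. The bounds squeeze it
  between a constant over \<open>ln k\<close> and \<open>r * ln (F k) / ln k\<close>; both vanish
  because \<open>F\<close> grows only logarithmically.\<close>

lemma min_edges_complete_asymp:
  assumes r: "3 \<le> r" "r < t"
  shows "\<exists>\<delta> :: nat \<Rightarrow> real. \<delta> \<longlonglongrightarrow> 0 \<and> (\<forall>\<^sub>F k in sequentially.
    real (min_edges r (complete_r_graph r t) k) = real k powr (real r + \<delta> k))"
proof -
  define m where "m k = real (min_edges r (complete_r_graph r t) k)" for k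
  define \<delta> where "\<delta> k = ln (m k) / ln (real k) - real r" for k
  define F where "F k = 16 * log 2 (real k) + 2 + real r" for k
  have "\<forall>\<^sub>F k in sequentially. F k \<le> real k" unfolding F_def by real_asymp
  then have bounds: "\<forall>\<^sub>F k in sequentially. 2 \<le> k \<and> 1 \<le> F k \<and>
      (real k / 4) ^ r \<le> m k \<and> m k \<le> (real k * F k) ^ r"
    using eventually_ge_at_top[of 2]
  proof eventually_elim
    case (elim k)
    have "0 \<le> log 2 (real k)" using elim by simp
    then have "1 \<le> F k" unfolding F_def by linarith
    then show ?case
      using min_edges_complete_bounds[OF r, of k] elim unfolding F_def m_def by auto
  qed
  have 1: "(\<lambda>k. - real r * ln 4 / ln (real k)) \<longlonglongrightarrow> 0" by real_asymp
  have 2: "(\<lambda>k. real r * ln (F k) / ln (real k)) \<longlonglongrightarrow> 0" unfolding F_def by real_asymp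
  have lo: "\<forall>\<^sub>F k in sequentially. - real r * ln 4 / ln (real k) \<le> \<delta> k"
    using bounds
  proof eventually_elim
    case (elim k)
    have "real r * (ln (real k) - ln 4) = ln ((real k / 4) ^ r)"
      using elim by (simp add: ln_realpow ln_div)
    also have "\<dots> \<le> ln (m k)" using elim by (intro ln_mono) auto
    finally show ?case using elim unfolding \<delta>_def by (simp add: field_simps)
  qed
  have up: "\<forall>\<^sub>F k in sequentially. \<delta> k \<le> real r * ln (F k) / ln (real k)"
    using bounds
  proof eventually_elim
    case (elim k)
    have "0 < (real k / 4) ^ r" using elim by simp
    then have "0 < m k" using elim by linarith
    then have "ln (m k) \<le> ln ((real k * F k) ^ r)" using elim by (intro ln_mono) auto
    also have "\<dots> = real r * (ln (real k) + ln (F k))"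
      using elim by (simp add: ln_realpow ln_mult)
    finally have "ln (m k) / ln (real k) \<le> real r * (ln (real k) + ln (F k)) / ln (real k)"
      using elim by (intro divide_right_mono) auto
    also have "\<dots> = real r + real r * ln (F k) / ln (real k)"
      using elim by (simp add: distrib_left add_divide_distrib)
    finally show ?case unfolding \<delta>_def by simp
  qed
  have "\<delta> \<longlonglongrightarrow> 0" by (rule tendsto_sandwich[OF lo up 1 2])
  moreover have "\<forall>\<^sub>F k in sequentially. m k = real k powr (real r + \<delta> k)"
    using bounds
  proof eventually_elim
    case (elim k)
    \<comment> \<open>Positivity of \<open>m k\<close> ensures that \<open>exp (ln (m k))\<close>
      returns \<open>m k\<close>.\<close>
    have "0 < (real k / 4) ^ r" using elim by simp
    then have "0 < m k" using elim by linarith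
    then show ?case using elim unfolding \<delta>_def powr_def by simp
  qed
  ultimately show ?thesis unfolding m_def by blast
qed

theorem theorem8:
  shows "(\<forall>r t :: nat. 3 \<le> r \<and> r < t \<longrightarrow>
            (\<exists>\<delta> :: nat \<Rightarrow> real. \<delta> \<longlonglongrightarrow> 0 \<and>
               (\<forall>\<^sub>F k in sequentially.
                  real (min_edges r (complete_r_graph r t) k) = real k powr (real r + \<delta> k))))
       \<and> (\<forall>s :: nat. 3 \<le> s \<longrightarrow>
            (\<exists>\<epsilon> :: real. \<epsilon> > 0 \<and>
               (\<forall>\<^sub>F k in sequentially.
                  real (min_edges 2 (complete_r_graph 2 s) k) > real k powr (2 + \<epsilon>))))"
  using min_edges_complete_asymp min_edges_clique_gt by blast

end
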